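(* Let $v$ be a typical weight on the open unit disk $\mathbb{D}$ and let $(z_n)_{n\in\mathbb{N}}\subset\mathbb{D}$ be a sequence of distinct points. Then the following assertions are equivalent: (a) $(z_n)$ is interpolating for $\mathcal{B}_v^\infty$, i.e. for every $(a_n)\in\ell_\infty$ there exists $f\in\mathcal{B}_v^\infty$ such that $v(z_n)f'(z_n)=a_n$ for all $n\in\mathbb{N}$. (b) $(z_n)$ is $c_0$-interpolating for $\mathcal{B}_v^0$, i.e. for every $(a_n)\in c_0$ there exists $f\in\mathcal{B}_v^0$ such that $v(z_n)f'(z_n)=a_n$ for all $n\in\mathbb{N}$. (c) $(z_n)$ is $c_0$-interpolating for $\mathcal{B}_v^\infty$, i.e. for every $(a_n)\in c_0$ there exists $f\in\mathcal{B}_v^\infty$ such that $v(z_n)f'(z_n)=a_n$ for all $n\in\mathbb{N}$. (d) $(z_n)$ interpolates idempotents of $\ell_\infty$ by functions of $\mathcal{B}_v^\infty$, i.e. for every sequence $(a_n)$ with $a_n\in\{0,1\}$ for all $n$ there exists $f\in\mathcal{B}_v^\infty$ such that $v(z_n)f'(z_n)=a_n$ for all $n\in\mathbb{N}$.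
   Context: $\mathbb{D}$ is the open unit disk of $\mathbb{C}$ and $H(\mathbb{D})$ is the space of complex analytic functions on $\mathbb{D}$. A weight $v$ is a strictly positive continuous function on $\mathbb{D}$; it is typical if it is radial ($v(z)=v(|z|)$ for all $z\in\mathbb{D}$), non-increasing (in $|z|$), and $\lim_{|z|\to1}v(z)=0$. The Bloch type spaces are $$\mathcal{B}_v^\infty=\{f\in H(\mathbb{D}):\ \|f\|_{\mathcal{B}_v^\infty}:=|f(0)|+\sup_{z\in\mathbb{D}}v(z)|f'(z)|<\infty\},\qquad \mathcal{B}_v^0=\{f\in\mathcal{B}_v^\infty:\ \lim_{|z|\to1^-}v(z)|f'(z)|=0\}.$$ $\ell_\infty$ is the space of bounded complex sequences and $c_0$ the subspace of sequences converging to $0$. *)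

theory Defs
  imports "HOL-Analysis.Analysis"
begin

abbreviation unit_disk :: "complex set" where
  "unit_disk \<equiv> ball 0 1"

(* The filter "|z| -> 1-", uniformly in the argument of z; it only sees points of the open disk
   close to the unit circle. *)
definition to_boundary :: "complex filter" where
  "to_boundary = filtercomap norm (at_left 1)"

(* Weights and analytic functions on the disk are represented by total functions; their values
   outside the disk are irrelevant to everything below. *)

definition weight :: "(complex \<Rightarrow> real) \<Rightarrow> bool" where
  "weight v \<longleftrightarrow> continuous_on unit_disk v \<and> (\<forall>z\<in>unit_disk. v z > 0)"

definition radial :: "(complex \<Rightarrow> real) \<Rightarrow> bool" where
  "radial v \<longleftrightarrow> (\<forall>z\<in>unit_disk. v z = v (of_real (norm z)))"

definition typical_weight :: "(complex \<Rightarrow> real) \<Rightarrow> bool" where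
  "typical_weight v \<longleftrightarrow> weight v \<and> radial v \<and>
     (\<forall>z\<in>unit_disk. \<forall>w\<in>unit_disk. norm z \<le> norm w \<longrightarrow> v w \<le> v z) \<and>
     (v \<longlongrightarrow> 0) to_boundary"

(* The norm takes values in [0, \<infinity>], so that it is meaningful for every analytic
   function; membership in the Bloch type space is its finiteness. *)
definition bloch_norm :: "(complex \<Rightarrow> real) \<Rightarrow> (complex \<Rightarrow> complex) \<Rightarrow> ennreal" where
  "bloch_norm v f =
     ennreal (norm (f 0)) + (SUP z\<in>unit_disk. ennreal (v z * norm (deriv f z)))"

definition bloch :: "(complex \<Rightarrow> real) \<Rightarrow> (complex \<Rightarrow> complex) set" where
  "bloch v = {f. f holomorphic_on unit_disk \<and> bloch_norm v f < \<infinity>}"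

definition little_bloch :: "(complex \<Rightarrow> real) \<Rightarrow> (complex \<Rightarrow> complex) set" where
  "little_bloch v = {f \<in> bloch v. ((\<lambda>z. v z * norm (deriv f z)) \<longlongrightarrow> 0) to_boundary}"

definition bounded_seqs :: "(nat \<Rightarrow> complex) set" where
  "bounded_seqs = {a. bounded (range a)}"

definition null_seqs :: "(nat \<Rightarrow> complex) set" where
  "null_seqs = {a. a \<longlonglongrightarrow> 0}"

definition idempotent_seqs :: "(nat \<Rightarrow> complex) set" where
  "idempotent_seqs = {a. \<forall>n. a n \<in> {0, 1}}"

definition interpolates ::
  "(complex \<Rightarrow> real) \<Rightarrow> (nat \<Rightarrow> complex) \<Rightarrow> (nat \<Rightarrow> complex) set \<Rightarrow> (complex \<Rightarrow> complex) set \<Rightarrow> bool"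
where
  "interpolates v z A F \<longleftrightarrow>
     (\<forall>a\<in>A. \<exists>f\<in>F. \<forall>n. of_real (v (z n)) * deriv f (z n) = a n)"

end

theory Submission
  imports Defs "HOL-Complex_Analysis.Great_Picard"
begin

text \<open>
  Only \<open>g = f'\<close> matters, since every analytic function on the disk has a primitive; so the
  problem concerns the analytic \<open>g\<close> with \<open>v |g|\<close> bounded. For such \<open>g\<close>, a bound
  \<open>v |g| \<le> C\<close> survives pointwise limits (Montel), hence the set of sequences interpolated with
  bound \<open>C\<close> is closed under pointwise limits. All four assertions turn out to be equivalent to
  one uniform statement: some \<open>C\<close> serves every sequence of zeros and ones.

  From (d) the uniform statement follows by the Baire category theorem on the Cantor space
  (\<open>uniform_selections\<close>). The same argument gives, for each fixed \<open>w\<close>, a common bound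
  for all sequences with entries in \<open>{0, w n}\<close>, as soon as each of them can be interpolated.
  Under (c) this applies to every null sequence \<open>w\<close>, and a sufficiently slowly decreasing \<open>w\<close>
  then yields the uniform statement (\<open>null_interpolation_imp_uniform_selections\<close>).

  Conversely, averaging binary digits turns the uniform bound for zero-one sequences into one
  for all sequences bounded by 1 (\<open>interpolable_complex_box\<close>), which is (a). To get (b), the
  interpolating function of a null sequence is replaced by an average of its dilations
  \<open>x \<mapsto> g (r x)\<close>. Each dilation vanishes at the boundary, because \<open>v\<close> does, and keeps the bound
  \<open>C\<close>, because \<open>v\<close> is radially non-increasing. The values of the dilations at the points \<open>z n\<close>
  converge only pointwise in \<open>n\<close>, but suitable averages converge uniformly
  (\<open>small_sum_of_null_seqs\<close>, a concrete case of Mazur's theorem in \<open>c\<^sub>0\<close>). So null sequences are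
  interpolated up to half of their norm, and iterating on the error gives exact interpolation
  (\<open>vanishing_interpolation_unit\<close>).
\<close>

section \<open>Weighted balls of analytic functions\<close>

text \<open>These are the derivatives of Bloch functions, graded by the seminorm that ignores \<open>f 0\<close>.\<close>

definition weighted_ball :: "(complex \<Rightarrow> real) \<Rightarrow> real \<Rightarrow> (complex \<Rightarrow> complex) set" where
  "weighted_ball v C = {g. g holomorphic_on unit_disk \<and> (\<forall>x\<in>unit_disk. v x * norm (g x) \<le> C)}"

definition vanishes_at_boundary :: "(complex \<Rightarrow> real) \<Rightarrow> (complex \<Rightarrow> complex) \<Rightarrow> bool" where
  "vanishes_at_boundary v g \<longleftrightarrow> ((\<lambda>x. v x * norm (g x)) \<longlongrightarrow> 0) to_boundary"

definition interpolable :: "(complex \<Rightarrow> real) \<Rightarrow> (nat \<Rightarrow> complex) \<Rightarrow> real \<Rightarrow> (nat \<Rightarrow> complex) \<Rightarrow> bool" where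
  "interpolable v z C a \<longleftrightarrow> (\<exists>g\<in>weighted_ball v C. \<forall>n. of_real (v (z n)) * g (z n) = a n)"

lemma weighted_ball_nonneg_radius:
  assumes "weight v" "g \<in> weighted_ball v C"
  shows "0 \<le> C"
proof -
  have "0 \<le> v 0 * norm (g 0)" using assms(1) by (simp add: weight_def less_imp_le)
  also have "\<dots> \<le> C" using assms(2) by (simp add: weighted_ball_def)
  finally show ?thesis .
qed

lemma weighted_ball_mono: "g \<in> weighted_ball v C \<Longrightarrow> C \<le> D \<Longrightarrow> g \<in> weighted_ball v D"
  by (force simp: weighted_ball_def)

lemma weighted_ball_zero: "0 \<le> C \<Longrightarrow> (\<lambda>x. 0) \<in> weighted_ball v C"
  by (simp add: weighted_ball_def)

lemma weighted_ball_add: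
  assumes "weight v" "g \<in> weighted_ball v C" "h \<in> weighted_ball v D"
  shows "(\<lambda>x. g x + h x) \<in> weighted_ball v (C + D)"
proof -
  have "v x * norm (g x + h x) \<le> C + D" if x: "x \<in> unit_disk" for x
  proof -
    have "v x * norm (g x + h x) \<le> v x * (norm (g x) + norm (h x))"
      using assms(1) x by (intro mult_left_mono norm_triangle_ineq) (auto simp: weight_def less_imp_le)
    also have "\<dots> \<le> C + D"
      using assms x by (auto simp: weighted_ball_def distrib_left intro: add_mono)
    finally show ?thesis .
  qed
  then show ?thesis using assms by (auto simp: weighted_ball_def intro!: holomorphic_intros)
qed

lemma weighted_ball_scale:
  assumes "g \<in> weighted_ball v C"
  shows "(\<lambda>x. c * g x) \<in> weighted_ball v (norm c * C)"
proof -
  have "v x * norm (c * g x) \<le> norm c * C" if x: "x \<in> unit_disk" for x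
  proof -
    have "norm c * (v x * norm (g x)) \<le> norm c * C"
      using assms x by (intro mult_left_mono) (auto simp: weighted_ball_def)
    then show ?thesis by (simp add: norm_mult mult_ac)
  qed
  then show ?thesis using assms by (auto simp: weighted_ball_def intro!: holomorphic_intros)
qed

lemma weighted_ball_sum:
  assumes "weight v" "finite I" "\<And>i. i \<in> I \<Longrightarrow> g i \<in> weighted_ball v (C i)"
  shows "(\<lambda>x. \<Sum>i\<in>I. g i x) \<in> weighted_ball v (\<Sum>i\<in>I. C i)"
  using assms(2,3)
  by (induction I rule: finite_induct) (auto simp: weighted_ball_zero intro!: weighted_ball_add assms(1))

text \<open>
  On a compact part of the disk \<open>v\<close> has a positive minimum, so the ball is locally uniformly
  bounded there and hence a normal family; the bound itself passes to pointwise limits.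
\<close>

lemma weighted_ball_Montel:
  assumes v: "weight v" and f: "\<And>k::nat. f k \<in> weighted_ball v C"
  obtains g r where "g \<in> weighted_ball v C" "strict_mono (r :: nat \<Rightarrow> nat)"
    "\<And>x. x \<in> unit_disk \<Longrightarrow> (\<lambda>k. f (r k) x) \<longlonglongrightarrow> g x"
proof -
  have bdd: "\<exists>B. \<forall>h\<in>weighted_ball v C. \<forall>x\<in>K. norm (h x) \<le> B"
    if K: "compact K" "K \<subseteq> unit_disk" for K
  proof (cases "K = {}")
    case False
    have "continuous_on K v" using v K continuous_on_subset by (auto simp: weight_def)
    then obtain x0 where x0: "x0 \<in> K" "\<And>x. x \<in> K \<Longrightarrow> v x0 \<le> v x"
      using continuous_attains_inf[OF K(1) False] by blast
    have pos: "0 < v x0" using v x0(1) K(2) by (auto simp: weight_def)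
    have "norm (h x) \<le> C / v x0" if "h \<in> weighted_ball v C" "x \<in> K" for h x
    proof -
      have "v x0 * norm (h x) \<le> v x * norm (h x)"
        using x0(2)[OF that(2)] by (intro mult_right_mono) auto
      also have "\<dots> \<le> C" using that K(2) by (auto simp: weighted_ball_def)
      finally show ?thesis using pos by (simp add: pos_le_divide_eq mult.commute)
    qed
    then show ?thesis by blast
  qed auto
  obtain g r where g: "g holomorphic_on unit_disk" "strict_mono (r :: nat \<Rightarrow> nat)"
    "\<And>x. x \<in> unit_disk \<Longrightarrow> (\<lambda>k. f (r k) x) \<longlonglongrightarrow> g x"
  proof (rule Montel[of unit_disk "weighted_ball v C" f])
    show "open unit_disk" by simp
    show "\<And>h. h \<in> weighted_ball v C \<Longrightarrow> h holomorphic_on unit_disk"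
      by (simp add: weighted_ball_def)
    show "range f \<subseteq> weighted_ball v C" using f by auto
  qed (use bdd in auto)
  have "v x * norm (g x) \<le> C" if x: "x \<in> unit_disk" for x
  proof (rule LIMSEQ_le_const2)
    show "(\<lambda>k. v x * norm (f (r k) x)) \<longlonglongrightarrow> v x * norm (g x)"
      by (intro tendsto_intros g x)
    show "\<exists>N. \<forall>k\<ge>N. v x * norm (f (r k) x) \<le> C"
      using f x by (auto simp: weighted_ball_def)
  qed
  with g show ?thesis by (intro that) (auto simp: weighted_ball_def)
qed

text \<open>
  A substitute for completeness of the weighted space. All partial sums lie in the ball of radius
  \<open>2 * C\<close>, so a subsequence of them converges to an element of that ball. The series converges
  pointwise by comparison with a geometric one, so that element is its sum.
\<close>

lemma weighted_ball_dyadic_series: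
  assumes v: "weight v" and g: "\<And>k. g k \<in> weighted_ball v (C / 2 ^ k)"
  obtains G where "G \<in> weighted_ball v (2 * C)" "\<And>x. x \<in> unit_disk \<Longrightarrow> (\<lambda>k. g k x) sums G x"
proof -
  have C: "0 \<le> C" using weighted_ball_nonneg_radius[OF v g[of 0]] by simp
  have geo: "(\<Sum>k<K. C / 2 ^ k) \<le> 2 * C" for K :: nat
  proof -
    have "(\<lambda>k. C * (1/2) ^ k) sums (C * (1 / (1 - 1/2)))"
      by (intro sums_mult geometric_sums) simp
    then have s: "(\<lambda>k. C / 2 ^ k) sums (2 * C)" by (simp add: power_one_over field_simps)
    then have "(\<Sum>k<K. C / 2 ^ k) \<le> (\<Sum>k. C / 2 ^ k)"
      by (intro sum_le_suminf) (auto simp: C sums_iff)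
    also have "\<dots> = 2 * C" using s by (simp add: sums_iff)
    finally show ?thesis .
  qed
  have partial: "(\<lambda>x. \<Sum>k<K. g k x) \<in> weighted_ball v (2 * C)" for K
    using weighted_ball_sum[OF v, of "{..<K}" g "\<lambda>k. C / 2 ^ k"] g geo weighted_ball_mono by blast
  obtain G r where G: "G \<in> weighted_ball v (2 * C)" "strict_mono (r :: nat \<Rightarrow> nat)"
    "\<And>x. x \<in> unit_disk \<Longrightarrow> (\<lambda>K. \<Sum>k<r K. g k x) \<longlonglongrightarrow> G x"
    using weighted_ball_Montel[where f="\<lambda>K x. \<Sum>k<K. g k x", OF v partial] by metis
  have "(\<lambda>k. g k x) sums G x" if x: "x \<in> unit_disk" for x
  proof -
    have pos: "0 < v x" using v x by (simp add: weight_def)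
    have "norm (g k x) \<le> (C / v x) * (1/2) ^ k" for k
    proof -
      have "v x * norm (g k x) \<le> C / 2 ^ k" using g[of k] x by (simp add: weighted_ball_def)
      then show ?thesis using pos by (simp add: field_simps power_one_over)
    qed
    moreover have "summable (\<lambda>k. (C / v x) * (1/2) ^ k)"
      by (intro summable_mult summable_geometric) simp
    ultimately have "summable (\<lambda>k. g k x)"
      by (intro summable_comparison_test'[of "\<lambda>k. (C / v x) * (1/2) ^ k" 0 "\<lambda>k. g k x"])
    then have lim: "(\<lambda>K. \<Sum>k<K. g k x) \<longlonglongrightarrow> (\<Sum>k. g k x)" by (rule summable_LIMSEQ)
    have "G x = (\<Sum>k. g k x)"
      using LIMSEQ_unique[OF G(3)[OF x]] LIMSEQ_subseq_LIMSEQ[OF lim G(2)] by (simp add: o_def)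
    with lim show ?thesis by (simp add: sums_def)
  qed
  with G(1) show ?thesis by (rule that)
qed

lemma eventually_in_disk: "eventually (\<lambda>x. x \<in> unit_disk) to_boundary"
  unfolding to_boundary_def eventually_filtercomap
  by (intro exI[of _ "\<lambda>t. t < 1"]) (auto simp: eventually_at_filter)

lemma vanishes_add:
  assumes v: "weight v" and g: "vanishes_at_boundary v g" "vanishes_at_boundary v h"
  shows "vanishes_at_boundary v (\<lambda>x. g x + h x)"
proof -
  have "((\<lambda>x. v x * norm (g x) + v x * norm (h x)) \<longlongrightarrow> 0) to_boundary"
    using tendsto_add[of _ 0 _ _ 0] g by (auto simp: vanishes_at_boundary_def)
  moreover have "eventually (\<lambda>x. norm (v x * norm (g x + h x)) \<le> v x * norm (g x) + v x * norm (h x)) to_boundary"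
    using eventually_in_disk
  proof eventually_elim
    case (elim x)
    then have "0 \<le> v x" using v by (simp add: weight_def less_imp_le)
    then show ?case by (simp add: abs_mult distrib_left[symmetric] mult_left_mono norm_triangle_ineq)
  qed
  ultimately show ?thesis unfolding vanishes_at_boundary_def
    by (rule Lim_null_comparison[rotated])
qed

lemma vanishes_scale:
  assumes "vanishes_at_boundary v g"
  shows "vanishes_at_boundary v (\<lambda>x. c * g x)"
  using tendsto_mult_right_zero[OF assms[unfolded vanishes_at_boundary_def], of "norm c"]
  by (simp add: vanishes_at_boundary_def norm_mult mult_ac)

lemma vanishes_sum:
  assumes "weight v" "finite I" "\<And>i. i \<in> I \<Longrightarrow> vanishes_at_boundary v (g i)"
  shows "vanishes_at_boundary v (\<lambda>x. \<Sum>i\<in>I. g i x)"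
  using assms(2,3)
proof (induction I rule: finite_induct)
  case empty
  then show ?case by (simp add: vanishes_at_boundary_def)
next
  case (insert i I)
  then show ?case using vanishes_add[OF assms(1), of "g i" "\<lambda>x. \<Sum>i\<in>I. g i x"] by simp
qed

text \<open>
  The tail beyond \<open>K\<close> is again a dyadic series, with constant \<open>C / 2 ^ K\<close>; its weighted norm is
  therefore small uniformly on the disk, and the finite part vanishes at the boundary.
\<close>

lemma vanishes_dyadic_series:
  assumes v: "weight v" and g: "\<And>k. g k \<in> weighted_ball v (C / 2 ^ k)"
    and van: "\<And>k. vanishes_at_boundary v (g k)"
    and G: "\<And>x. x \<in> unit_disk \<Longrightarrow> (\<lambda>k. g k x) sums G x"
  shows "vanishes_at_boundary v G"
  unfolding vanishes_at_boundary_def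
proof (rule tendstoI)
  fix e :: real assume e: "0 < e"
  have "(\<lambda>K. 2 * C * (1/2) ^ K) \<longlonglongrightarrow> 0"
    by (intro tendsto_mult_right_zero LIMSEQ_power_zero) simp
  then have "eventually (\<lambda>K. 2 * C * (1/2) ^ K < e / 2) sequentially"
    using e by (intro order_tendstoD(2)) auto
  then obtain K where K: "2 * (C / 2 ^ K) < e / 2"
    by (auto simp: eventually_sequentially power_one_over)
  have "g (k + K) \<in> weighted_ball v ((C / 2 ^ K) / 2 ^ k)" for k
    using g[of "k + K"] by (simp add: power_add mult_ac)
  from weighted_ball_dyadic_series[of v "\<lambda>k. g (k + K)", OF v this]
  obtain T where T: "T \<in> weighted_ball v (2 * (C / 2 ^ K))"
    "\<And>x. x \<in> unit_disk \<Longrightarrow> (\<lambda>k. g (k + K) x) sums T x" by blast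
  have split: "G x = (\<Sum>k<K. g k x) + T x" if "x \<in> unit_disk" for x
    using sums_unique2[OF G[OF that]] T(2)[OF that] sums_iff_shift[of "\<lambda>k. g k x" K "T x"]
    by (simp add: add.commute)
  have "vanishes_at_boundary v (\<lambda>x. \<Sum>k<K. g k x)" by (intro vanishes_sum v van) auto
  then have "eventually (\<lambda>x. v x * norm (\<Sum>k<K. g k x) < e / 2) to_boundary"
    unfolding vanishes_at_boundary_def using e by (intro order_tendstoD(2)) auto
  moreover note eventually_in_disk
  ultimately show "eventually (\<lambda>x. dist (v x * norm (G x)) 0 < e) to_boundary"
  proof eventually_elim
    case (elim x)
    have pos: "0 \<le> v x" using v elim by (simp add: weight_def less_imp_le)
    have "v x * norm (G x) \<le> v x * norm (\<Sum>k<K. g k x) + v x * norm (T x)"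
      unfolding split[OF elim(2)] distrib_left[symmetric] using pos
      by (intro mult_left_mono norm_triangle_ineq)
    also have "v x * norm (T x) \<le> 2 * (C / 2 ^ K)"
      using T(1) elim(2) by (simp add: weighted_ball_def)
    finally show ?case using pos elim(1) K by (simp add: abs_mult)
  qed
qed

section \<open>Dilations\<close>

text \<open>
  Dilation moves points towards the origin, where \<open>v\<close> is at least as large, so it does not increase the
  weighted norm. The dilated function is bounded on the disk, and \<open>v\<close> tends to 0 at the boundary.
\<close>

lemma weighted_ball_dilation:
  assumes v: "typical_weight v" and r: "0 < r" "r < 1" and g: "g \<in> weighted_ball v C"
  shows "(\<lambda>x. g (of_real r * x)) \<in> weighted_ball v C"
    and "vanishes_at_boundary v (\<lambda>x. g (of_real r * x))"
proof -
  have hol: "g holomorphic_on unit_disk" using g by (simp add: weighted_ball_def)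
  have small: "norm (of_real r * x) \<le> r" if "x \<in> unit_disk" for x :: complex
    using that r by (simp add: norm_mult mult_left_le)
  have maps: "of_real r * x \<in> unit_disk" if "x \<in> unit_disk" for x :: complex
    using small[OF that] r by simp
  have "v x * norm (g (of_real r * x)) \<le> C" if x: "x \<in> unit_disk" for x
  proof -
    have "norm (of_real r * x) \<le> norm x"
      using r by (simp add: norm_mult mult_left_le_one_le)
    then have "v x \<le> v (of_real r * x)"
      using v x maps[OF x] unfolding typical_weight_def by blast
    then have "v x * norm (g (of_real r * x)) \<le> v (of_real r * x) * norm (g (of_real r * x))"
      by (intro mult_right_mono) auto
    also have "\<dots> \<le> C" using g maps[OF x] by (simp add: weighted_ball_def)
    finally show ?thesis .
  qed
  moreover have "(\<lambda>x. g (of_real r * x)) holomorphic_on unit_disk"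
  proof (rule holomorphic_on_compose_gen[of "\<lambda>x. of_real r * x" unit_disk g unit_disk, unfolded o_def])
    show "(*) (complex_of_real r) ` unit_disk \<subseteq> unit_disk" using maps by blast
  qed (auto intro!: holomorphic_intros hol)
  ultimately show "(\<lambda>x. g (of_real r * x)) \<in> weighted_ball v C"
    by (simp add: weighted_ball_def)
  have "continuous_on (cball 0 r) g"
    using holomorphic_on_imp_continuous_on[OF hol] r by (auto intro: continuous_on_subset)
  then have "bounded (g ` cball 0 r)"
    by (intro compact_imp_bounded compact_continuous_image) auto
  then obtain B where "\<forall>y\<in>cball 0 r. norm (g y) \<le> B"
    by (auto simp: bounded_iff)
  then have B: "norm (g y) \<le> B" if "norm y \<le> r" for y
    using that by simp
  have vlim: "((\<lambda>x. v x * B) \<longlongrightarrow> 0) to_boundary"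
    using v by (intro tendsto_mult_left_zero) (simp add: typical_weight_def)
  from eventually_in_disk have "eventually (\<lambda>x. norm (v x * norm (g (of_real r * x))) \<le> v x * B) to_boundary"
  proof eventually_elim
    case (elim x)
    then have "0 \<le> v x" using v by (simp add: typical_weight_def weight_def less_imp_le)
    then show ?case using B[OF small[OF elim]] by (simp add: abs_mult mult_left_mono)
  qed
  then show "vanishes_at_boundary v (\<lambda>x. g (of_real r * x))"
    unfolding vanishes_at_boundary_def using vlim by (rule Lim_null_comparison)
qed

section \<open>Passage to the derivative\<close>

lemma bloch_iff:
  assumes "weight v"
  shows "f \<in> bloch v \<longleftrightarrow> f holomorphic_on unit_disk \<and> (\<exists>C. deriv f \<in> weighted_ball v C)"
proof -
  have "bloch_norm v f < \<infinity> \<longleftrightarrow> (\<exists>C. \<forall>x\<in>unit_disk. v x * norm (deriv f x) \<le> C)"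
  proof
    assume "bloch_norm v f < \<infinity>"
    then have "(SUP x\<in>unit_disk. ennreal (v x * norm (deriv f x))) < \<infinity>"
      by (simp add: bloch_norm_def ennreal_add_less_top)
    then obtain C where C: "0 \<le> C" "(SUP x\<in>unit_disk. ennreal (v x * norm (deriv f x))) = ennreal C"
      by (metis ennreal_cases infinity_ennreal_def less_irrefl)
    have "v x * norm (deriv f x) \<le> C" if "x \<in> unit_disk" for x
    proof -
      have "ennreal (v x * norm (deriv f x)) \<le> ennreal C"
        unfolding C(2)[symmetric] using that by (rule SUP_upper)
      then show ?thesis using C(1) by (simp add: ennreal_le_iff)
    qed
    then show "\<exists>C. \<forall>x\<in>unit_disk. v x * norm (deriv f x) \<le> C" by blast
  next
    assume "\<exists>C. \<forall>x\<in>unit_disk. v x * norm (deriv f x) \<le> C"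
    then obtain C where "\<forall>x\<in>unit_disk. v x * norm (deriv f x) \<le> C" by blast
    then have "(SUP x\<in>unit_disk. ennreal (v x * norm (deriv f x))) \<le> ennreal C"
      by (intro SUP_least ennreal_leI) auto
    then have "(SUP x\<in>unit_disk. ennreal (v x * norm (deriv f x))) < \<infinity>"
      by (rule le_less_trans) simp
    then show "bloch_norm v f < \<infinity>" by (simp add: bloch_norm_def ennreal_add_less_top)
  qed
  then show ?thesis
    by (auto simp: bloch_def weighted_ball_def intro!: holomorphic_deriv)
qed

lemma little_bloch_iff: "f \<in> little_bloch v \<longleftrightarrow> f \<in> bloch v \<and> vanishes_at_boundary v (deriv f)"
  by (simp add: little_bloch_def vanishes_at_boundary_def)

lemma bloch_primitive:
  assumes v: "weight v" and g: "g \<in> weighted_ball v C"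
  obtains f where "f \<in> bloch v" "\<And>x. x \<in> unit_disk \<Longrightarrow> deriv f x = g x"
proof -
  have "g holomorphic_on unit_disk" using g by (simp add: weighted_ball_def)
  then obtain f where f: "\<And>x. x \<in> unit_disk \<Longrightarrow> (f has_field_derivative g x) (at x within unit_disk)"
    using holomorphic_convex_primitive'[of unit_disk g] by auto
  have der: "deriv f x = g x" if "x \<in> unit_disk" for x
    using f[OF that] that at_within_open[of x unit_disk] by (auto intro: DERIV_imp_deriv)
  have hol: "f holomorphic_on unit_disk"
    unfolding holomorphic_on_def field_differentiable_def using f by blast
  have "deriv f \<in> weighted_ball v C"
    using g der holomorphic_deriv[OF hol] by (auto simp: weighted_ball_def)
  then have "f \<in> bloch v" using hol bloch_iff[OF v] by blast
  then show ?thesis using der by (rule that)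
qed

lemma interpolates_bloch_iff:
  assumes v: "weight v" and z: "range z \<subseteq> unit_disk"
  shows "interpolates v z A (bloch v) \<longleftrightarrow> (\<forall>a\<in>A. \<exists>C. interpolable v z C a)"
proof -
  have "(\<exists>f\<in>bloch v. \<forall>n. of_real (v (z n)) * deriv f (z n) = a n) \<longleftrightarrow> (\<exists>C. interpolable v z C a)" for a
  proof
    assume "\<exists>C. interpolable v z C a"
    then obtain g C where g: "g \<in> weighted_ball v C" "\<And>n. of_real (v (z n)) * g (z n) = a n"
      by (auto simp: interpolable_def)
    from bloch_primitive[OF v g(1)] obtain f where
      f: "f \<in> bloch v" "\<And>x. x \<in> unit_disk \<Longrightarrow> deriv f x = g x" by blast
    have "deriv f (z n) = g (z n)" for n using f(2) z by blast
    with f(1) g(2) show "\<exists>f\<in>bloch v. \<forall>n. of_real (v (z n)) * deriv f (z n) = a n"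
      by (intro bexI[of _ f]) auto
  next
    assume "\<exists>f\<in>bloch v. \<forall>n. of_real (v (z n)) * deriv f (z n) = a n"
    then show "\<exists>C. interpolable v z C a"
      unfolding interpolable_def using bloch_iff[OF v] by blast
  qed
  then show ?thesis by (simp add: interpolates_def)
qed

lemma interpolates_little_blochI:
  assumes v: "weight v" and z: "range z \<subseteq> unit_disk"
    and A: "\<And>a. a \<in> A \<Longrightarrow> \<exists>g C. g \<in> weighted_ball v C \<and> vanishes_at_boundary v g \<and>
              (\<forall>n. of_real (v (z n)) * g (z n) = a n)"
  shows "interpolates v z A (little_bloch v)"
  unfolding interpolates_def
proof
  fix a assume "a \<in> A"
  from A[OF this] obtain g C where g: "g \<in> weighted_ball v C" "vanishes_at_boundary v g"
    "\<And>n. of_real (v (z n)) * g (z n) = a n" by blast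
  from bloch_primitive[OF v g(1)] obtain f where
    f: "f \<in> bloch v" "\<And>x. x \<in> unit_disk \<Longrightarrow> deriv f x = g x" by blast
  from eventually_in_disk have "eventually (\<lambda>x. v x * norm (g x) = v x * norm (deriv f x)) to_boundary"
    by eventually_elim (simp add: f)
  then have "vanishes_at_boundary v (deriv f)"
    using g(2) unfolding vanishes_at_boundary_def by (rule Lim_transform_eventually[rotated])
  moreover have "deriv f (z n) = g (z n)" for n using f(2) z by blast
  ultimately show "\<exists>f\<in>little_bloch v. \<forall>n. of_real (v (z n)) * deriv f (z n) = a n"
    using f(1) g(3) by (intro bexI[of _ f]) (auto simp: little_bloch_iff)
qed

section \<open>Interpolation with a fixed bound\<close>

lemma interpolable_mono: "interpolable v z C a \<Longrightarrow> C \<le> D \<Longrightarrow> interpolable v z D a"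
  unfolding interpolable_def using weighted_ball_mono by blast

lemma interpolable_zero: "0 \<le> C \<Longrightarrow> interpolable v z C (\<lambda>n. 0)"
  unfolding interpolable_def by (rule bexI[OF _ weighted_ball_zero]) auto

lemma interpolable_add:
  assumes "weight v" "interpolable v z C a" "interpolable v z D b"
  shows "interpolable v z (C + D) (\<lambda>n. a n + b n)"
proof -
  obtain g where g: "g \<in> weighted_ball v C" "\<And>n. of_real (v (z n)) * g (z n) = a n"
    using assms(2) by (auto simp: interpolable_def)
  obtain h where h: "h \<in> weighted_ball v D" "\<And>n. of_real (v (z n)) * h (z n) = b n"
    using assms(3) by (auto simp: interpolable_def)
  show ?thesis unfolding interpolable_def
    by (rule bexI[OF _ weighted_ball_add[OF assms(1) g(1) h(1)]]) (simp add: distrib_left g h)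
qed

lemma interpolable_scale:
  assumes "interpolable v z C a"
  shows "interpolable v z (norm c * C) (\<lambda>n. c * a n)"
proof -
  obtain g where g: "g \<in> weighted_ball v C" "\<And>n. of_real (v (z n)) * g (z n) = a n"
    using assms by (auto simp: interpolable_def)
  have "of_real (v (z n)) * (c * g (z n)) = c * a n" for n
    by (simp add: g(2)[symmetric])
  then show ?thesis unfolding interpolable_def
    by (intro bexI[OF _ weighted_ball_scale[OF g(1)]]) auto
qed

lemma interpolable_diff:
  assumes "weight v" "interpolable v z C a" "interpolable v z D b"
  shows "interpolable v z (C + D) (\<lambda>n. a n - b n)"
  using interpolable_add[OF assms(1,2) interpolable_scale[OF assms(3), of "-1"]] by simp

lemma interpolable_limit:
  assumes v: "weight v" and z: "range z \<subseteq> unit_disk"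
    and A: "\<And>k. interpolable v z C (A k)" and lim: "\<And>n. (\<lambda>k. A k n) \<longlonglongrightarrow> a n"
  shows "interpolable v z C a"
proof -
  obtain f where f: "\<And>k. f k \<in> weighted_ball v C" "\<And>k n. of_real (v (z n)) * f k (z n) = A k n"
  proof -
    have "\<forall>k. \<exists>g. g \<in> weighted_ball v C \<and> (\<forall>n. of_real (v (z n)) * g (z n) = A k n)"
      using A unfolding interpolable_def by blast
    from choice[OF this] show ?thesis using that by blast
  qed
  obtain g r where g: "g \<in> weighted_ball v C" "strict_mono (r :: nat \<Rightarrow> nat)"
    "\<And>x. x \<in> unit_disk \<Longrightarrow> (\<lambda>k. f (r k) x) \<longlonglongrightarrow> g x"
    using weighted_ball_Montel[of v f, OF v f(1)] by blast
  have "of_real (v (z n)) * g (z n) = a n" for n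
  proof (rule LIMSEQ_unique)
    have "(\<lambda>k. of_real (v (z n)) * f (r k) (z n)) \<longlonglongrightarrow> of_real (v (z n)) * g (z n)"
      by (intro tendsto_intros g(3)) (use z in blast)
    then show "(\<lambda>k. A (r k) n) \<longlonglongrightarrow> of_real (v (z n)) * g (z n)" by (simp add: f(2))
    show "(\<lambda>k. A (r k) n) \<longlonglongrightarrow> a n"
      using LIMSEQ_subseq_LIMSEQ[OF lim[of n] g(2)] by (simp add: o_def)
  qed
  with g(1) show ?thesis by (auto simp: interpolable_def)
qed

text \<open>
  Interpolating zero-one sequences is the case \<open>w = 1\<close>; the general \<open>w\<close> makes the Baire argument
  below applicable also when only null sequences can be interpolated.
\<close>

definition selection :: "(nat \<Rightarrow> real) \<Rightarrow> (nat \<Rightarrow> bool) \<Rightarrow> nat \<Rightarrow> complex" where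
  "selection w s n = (if s n then of_real (w n) else 0)"

text \<open>
  Binary expansion: with \<open>e n\<close> the first digit of \<open>c n\<close>, the remainder \<open>2 * c n - e n\<close> is again
  in \<open>[0, 1]\<close>, and averaging an approximation of it with the digit halves the error. As the bound
  of the average of two sequences is the average of their bounds, \<open>C\<close> does not grow.
\<close>

lemma interpolable_box:
  assumes v: "weight v" and z: "range z \<subseteq> unit_disk"
    and sel: "\<And>s. interpolable v z C (selection w s)"
    and c: "\<And>n. 0 \<le> c n" "\<And>n. c n \<le> (1::real)"
  shows "interpolable v z C (\<lambda>n. of_real (c n * w n))"
proof -
  have approx: "\<exists>b. interpolable v z C (\<lambda>n. of_real (b n * w n)) \<and> (\<forall>n. \<bar>b n - c n\<bar> \<le> (1/2) ^ K)"
    if "\<And>n. 0 \<le> c n" "\<And>n. c n \<le> (1::real)" for K and c :: "nat \<Rightarrow> real"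
    using that
  proof (induction K arbitrary: c)
    case 0
    have "interpolable v z C (\<lambda>n. of_real (0 * w n))"
      using sel[of "\<lambda>n. False"] by (simp add: selection_def[abs_def])
    then show ?case using 0 by (intro exI[of _ "\<lambda>n. 0"]) auto
  next
    case (Suc K)
    define e :: "nat \<Rightarrow> bool" where "e n \<longleftrightarrow> 1/2 \<le> c n" for n
    have "\<And>n. 0 \<le> 2 * c n - of_bool (e n)" "\<And>n. 2 * c n - of_bool (e n) \<le> 1"
      using Suc.prems by (auto simp: e_def)
    from Suc.IH[of "\<lambda>n. 2 * c n - of_bool (e n)", OF this] obtain b where b: "interpolable v z C (\<lambda>n. of_real (b n * w n))"
      "\<And>n. \<bar>b n - (2 * c n - of_bool (e n))\<bar> \<le> (1/2) ^ K" by blast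
    have "interpolable v z (norm (1/2 :: complex) * (C + C))
        (\<lambda>n. 1/2 * (of_real (b n * w n) + selection w e n))"
      by (intro interpolable_scale interpolable_add v b(1) sel)
    also have "(\<lambda>n. 1/2 * (of_real (b n * w n) + selection w e n)) =
        (\<lambda>n. of_real ((b n + of_bool (e n)) / 2 * w n))"
      by (auto simp: selection_def fun_eq_iff algebra_simps add_divide_distrib)
    finally have "interpolable v z C (\<lambda>n. of_real ((b n + of_bool (e n)) / 2 * w n))" by simp
    moreover have "\<bar>(b n + of_bool (e n)) / 2 - c n\<bar> \<le> (1/2) ^ Suc K" for n
    proof -
      have "\<bar>(b n + of_bool (e n)) / 2 - c n\<bar> = \<bar>b n - (2 * c n - of_bool (e n))\<bar> / 2"
        by (cases "e n") (auto simp: abs_if field_simps)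
      with b(2)[of n] show ?thesis by simp
    qed
    ultimately show ?case by (intro exI[of _ "\<lambda>n. (b n + of_bool (e n)) / 2"] conjI allI)
  qed
  have "\<forall>K. \<exists>b. interpolable v z C (\<lambda>n. of_real (b n * w n)) \<and> (\<forall>n. \<bar>b n - c n\<bar> \<le> (1/2) ^ K)"
    by (intro allI approx c)
  from choice[OF this] obtain b where b: "\<And>K. interpolable v z C (\<lambda>n. of_real (b K n * w n))"
    "\<And>K n. \<bar>b K n - c n\<bar> \<le> (1/2) ^ K" by blast
  show ?thesis
  proof (rule interpolable_limit[OF v z b(1)])
    fix n
    have "(\<lambda>K. b K n) \<longlonglongrightarrow> c n"
      by (rule LIM_zero_cancel, rule Lim_null_comparison[of _ "\<lambda>K. (1/2) ^ K"])
        (use b(2) in \<open>auto intro!: LIMSEQ_power_zero\<close>)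
    then show "(\<lambda>K. complex_of_real (b K n * w n)) \<longlonglongrightarrow> of_real (c n * w n)"
      by (intro tendsto_intros)
  qed
qed

text \<open>The factor 4 comes from the positive and negative parts of the real and imaginary parts.\<close>

lemma interpolable_complex_box:
  assumes v: "weight v" and z: "range z \<subseteq> unit_disk"
    and sel: "\<And>s. interpolable v z C (selection (\<lambda>n. 1) s)"
    and a: "\<And>n. norm (a n) \<le> 1"
  shows "interpolable v z (4 * C) a"
proof -
  have box: "interpolable v z C (\<lambda>n. of_real (c n))" if "\<And>n. 0 \<le> c n" "\<And>n. c n \<le> 1" for c
    using interpolable_box[OF v z sel that] by simp
  have re: "\<bar>Re (a n)\<bar> \<le> 1" and im: "\<bar>Im (a n)\<bar> \<le> 1" for n
    using abs_Re_le_cmod[of "a n"] abs_Im_le_cmod[of "a n"] a[of n] by linarith+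
  have "interpolable v z ((C + C) + norm \<i> * (C + C))
     (\<lambda>n. (of_real (max 0 (Re (a n))) - of_real (max 0 (- Re (a n)))) +
           \<i> * (of_real (max 0 (Im (a n))) - of_real (max 0 (- Im (a n)))))"
    using re im
    by (intro interpolable_add interpolable_diff interpolable_scale v box) (auto simp: abs_le_iff)
  also have "(\<lambda>n. (of_real (max 0 (Re (a n))) - of_real (max 0 (- Re (a n)))) +
           \<i> * (of_real (max 0 (Im (a n))) - of_real (max 0 (- Im (a n))))) = a"
    by (auto simp: fun_eq_iff complex_eq_iff max_def)
  finally show ?thesis by simp
qed

section \<open>Uniform bounds by the Baire category argument\<close>

text \<open>
  The Baire category theorem for the Cantor space: if closed sets cover it, one of them contains a
  cylinder. Otherwise the \<open>m\<close>-th set can be avoided, for each \<open>m\<close> in turn, on a smaller cylinder,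
  and the sequence defined by these nested cylinders lies in none of the sets.
\<close>

lemma bool_seq_Baire:
  fixes P :: "nat \<Rightarrow> (nat \<Rightarrow> bool) \<Rightarrow> bool"
  assumes ex: "\<And>s. \<exists>m. P m s"
    and closed: "\<And>m S s. (\<And>k. P m (S k)) \<Longrightarrow> (\<And>k n. n < k \<Longrightarrow> S k n = s n) \<Longrightarrow> P m s"
  obtains m N \<sigma> where "\<And>s. (\<And>n. n < N \<Longrightarrow> s n = \<sigma> n) \<Longrightarrow> P m s"
proof (rule ccontr)
  assume "\<not> thesis"
  with that have none: "\<exists>s. (\<forall>n<N. s n = \<sigma> n) \<and> \<not> P m s" for m N \<sigma> by blast
  \<comment> \<open>A pair \<open>(N, \<sigma>)\<close> stands for the cylinder of the sequences that agree with \<open>\<sigma>\<close> below \<open>N\<close>.\<close>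
  define R where "R m = (\<lambda>(N, \<sigma>) (N', \<sigma>'). N < N' \<and> (\<forall>n<N. \<sigma>' n = \<sigma> n) \<and>
      (\<forall>s. (\<forall>n<N'. s n = \<sigma>' n) \<longrightarrow> \<not> P m s))" for m and p q :: "nat \<times> (nat \<Rightarrow> bool)"
  have step: "\<exists>q. R m p q" for m p
  proof -
    obtain N \<sigma> where p: "p = (N, \<sigma>)" by (cases p)
    obtain t where t: "\<forall>n<N. t n = \<sigma> n" "\<not> P m t" using none by blast
    have "\<exists>k. \<forall>s. (\<forall>n<k. s n = t n) \<longrightarrow> \<not> P m s"
    proof (rule ccontr)
      assume "\<not> ?thesis"
      then have "\<forall>k. \<exists>s. (\<forall>n<k. s n = t n) \<and> P m s" by blast
      then obtain S where "\<And>k. (\<forall>n<k. S k n = t n) \<and> P m (S k)" by metis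
      with closed[of m S t] t(2) show False by blast
    qed
    then obtain k where k: "\<And>s. (\<forall>n<k. s n = t n) \<Longrightarrow> \<not> P m s" by blast
    have "R m p (max k (Suc N), t)" using t(1) k by (auto simp: R_def p)
    then show ?thesis by blast
  qed
  define X where "X = rec_nat (0, \<lambda>n. False) (\<lambda>m p. SOME q. R m p q)"
  have X: "R m (X m) (X (Suc m))" for m
    unfolding X_def by (simp add: someI_ex[OF step])
  define N \<sigma> where "N m = fst (X m)" and "\<sigma> m = snd (X m)" for m
  have grow: "N m < N (Suc m)" and agree: "\<And>n. n < N m \<Longrightarrow> \<sigma> (Suc m) n = \<sigma> m n"
    and avoid: "\<And>s. (\<forall>n<N (Suc m). s n = \<sigma> (Suc m) n) \<Longrightarrow> \<not> P m s" for m
    using X[of m] by (auto simp: R_def N_def \<sigma>_def case_prod_beta)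
  have N_mono: "N i \<le> N j" if "i \<le> j" for i j
    using lift_Suc_mono_le[of N, OF less_imp_le[OF grow] that] .
  have N_ge: "m \<le> N m" for m
  proof (induction m)
    case (Suc m)
    then show ?case using grow[of m] by linarith
  qed simp
  have stable: "\<sigma> j n = \<sigma> i n" if "i \<le> j" "n < N i" for i j n
    using that
  proof (induction j rule: dec_induct)
    case (step j)
    then show ?case using agree[of n j] N_mono[of i j] by auto
  qed simp
  define s where "s n = \<sigma> (Suc n) n" for n
  have "s n = \<sigma> (Suc m) n" if "n < N (Suc m)" for m n
  proof (cases "n \<le> m")
    case True
    then show ?thesis using stable[of "Suc n" "Suc m" n] N_ge[of "Suc n"] by (simp add: s_def)
  next
    case False
    then show ?thesis using stable[of "Suc m" "Suc n" n] that by (simp add: s_def)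
  qed
  then have "\<not> P m s" for m using avoid by blast
  with ex show False by blast
qed

lemma uniform_finite_selections:
  assumes v: "weight v" and ex: "\<And>s. \<exists>C. interpolable v z C (selection w s)"
  shows "\<exists>C. \<forall>s. interpolable v z C (selection w (\<lambda>n. n < N \<and> s n))"
proof (induction N)
  case 0
  show ?case using interpolable_zero[of 0] by (auto simp: selection_def[abs_def] intro!: exI[of _ 0])
next
  case (Suc N)
  then obtain C where C: "\<And>s. interpolable v z C (selection w (\<lambda>n. n < N \<and> s n))" by blast
  obtain D where D: "interpolable v z D (selection w (\<lambda>n. n = N))" using ex by blast
  have D0: "0 \<le> D" using D weighted_ball_nonneg_radius[OF v] by (auto simp: interpolable_def)
  have "interpolable v z (C + D) (selection w (\<lambda>n. n < Suc N \<and> s n))" for s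
  proof (cases "s N")
    case True
    have "selection w (\<lambda>n. n < Suc N \<and> s n) =
        (\<lambda>n. selection w (\<lambda>n. n < N \<and> s n) n + selection w (\<lambda>n. n = N) n)"
      using True by (auto simp: selection_def fun_eq_iff less_Suc_eq)
    then show ?thesis using interpolable_add[OF v C D] by simp
  next
    case False
    then have "(\<lambda>n. n < Suc N \<and> s n) = (\<lambda>n. n < N \<and> s n)" by (auto simp: less_Suc_eq)
    then show ?thesis using interpolable_mono[OF C, of "C + D"] D0 by simp
  qed
  then show ?case by blast
qed

text \<open>
  Baire gives a common bound on one cylinder. A difference of two elements of the cylinder is an
  arbitrary selection beyond \<open>N\<close>, and only finitely many selections live below \<open>N\<close>.
\<close>

lemma uniform_selections:
  assumes v: "weight v" and z: "range z \<subseteq> unit_disk"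
    and ex: "\<And>s. \<exists>C. interpolable v z C (selection w s)"
  shows "\<exists>C. \<forall>s. interpolable v z C (selection w s)"
proof -
  obtain m N \<sigma> where cyl: "\<And>s. (\<And>n. n < N \<Longrightarrow> s n = \<sigma> n) \<Longrightarrow> interpolable v z (real m) (selection w s)"
  proof (rule bool_seq_Baire[of "\<lambda>m s. interpolable v z (real m) (selection w s)"])
    fix s
    obtain C where "interpolable v z C (selection w s)" using ex by blast
    then show "\<exists>m. interpolable v z (real m) (selection w s)"
      using real_arch_simple[of C] interpolable_mono by blast
  next
    fix m S s
    assume S: "\<And>k. interpolable v z (real m) (selection w (S k))"
      and eq: "\<And>k n. n < k \<Longrightarrow> S k n = s n"
    show "interpolable v z (real m) (selection w s)"
    proof (rule interpolable_limit[OF v z S])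
      fix n
      have "eventually (\<lambda>k. selection w (S k) n = selection w s n) sequentially"
        using eventually_gt_at_top[of n] by eventually_elim (simp add: selection_def eq)
      then show "(\<lambda>k. selection w (S k) n) \<longlonglongrightarrow> selection w s n" by (rule tendsto_eventually)
    qed
  qed blast
  obtain D where D: "\<And>s. interpolable v z D (selection w (\<lambda>n. n < N \<and> s n))"
    using uniform_finite_selections[OF v ex] by blast
  have "interpolable v z (D + (real m + real m)) (selection w s)" for s
  proof -
    define s1 where "s1 n \<longleftrightarrow> (if n < N then \<sigma> n else s n)" for n
    define s0 where "s0 n \<longleftrightarrow> (if n < N then \<sigma> n else False)" for n
    have "selection w s = (\<lambda>n. selection w (\<lambda>n. n < N \<and> s n) n + (selection w s1 n - selection w s0 n))"
      by (auto simp: selection_def fun_eq_iff s0_def s1_def)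
    moreover have "interpolable v z (D + (real m + real m))
        (\<lambda>n. selection w (\<lambda>n. n < N \<and> s n) n + (selection w s1 n - selection w s0 n))"
      by (intro interpolable_add interpolable_diff v D cyl) (auto simp: s0_def s1_def)
    ultimately show ?thesis by simp
  qed
  then show ?thesis by blast
qed

text \<open>
  Let \<open>c k\<close> be the least natural number that is a bound for zero-one sequences supported below \<open>k\<close>. If \<open>c\<close> were
  unbounded, then \<open>w n = 1 / sqrt (1 + c (n + 1))\<close> would be a null sequence, and the selections
  from \<open>w\<close> would have a common bound \<open>C\<close>. A zero-one sequence supported below \<open>k\<close> is
  \<open>sqrt (1 + c k)\<close> times a sequence with values between 0 and \<open>w\<close>. Hence \<open>c k\<close> is at most
  \<open>C * sqrt (1 + c k) + 1\<close>, which keeps \<open>c\<close> bounded after all.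
\<close>

lemma null_interpolation_imp_uniform_selections:
  assumes v: "weight v" and z: "range z \<subseteq> unit_disk"
    and null: "\<And>a. a \<longlonglongrightarrow> 0 \<Longrightarrow> \<exists>C. interpolable v z C a"
  shows "\<exists>C. \<forall>s. interpolable v z C (selection (\<lambda>n. 1) s)"
proof -
  define Q where "Q k m \<longleftrightarrow> (\<forall>s. interpolable v z (real m) (selection (\<lambda>n. 1) (\<lambda>n. n < k \<and> s n)))" for k m
  have Q_ex: "\<exists>m. Q k m" for k
  proof -
    have "\<exists>C. interpolable v z C (selection (\<lambda>n. of_bool (n < k)) s)" for s
    proof (rule null, rule tendsto_eventually)
      show "eventually (\<lambda>n. selection (\<lambda>n. of_bool (n < k)) s n = 0) sequentially"
        using eventually_ge_at_top[of k] by eventually_elim (simp add: selection_def)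
    qed
    from uniform_selections[OF v z this]
    obtain C where C: "\<And>s. interpolable v z C (selection (\<lambda>n. of_bool (n < k)) s)" by blast
    obtain m where m: "C \<le> real m" using real_arch_simple by blast
    have "selection (\<lambda>n. 1) (\<lambda>n. n < k \<and> s n) = selection (\<lambda>n. of_bool (n < k)) s" for s
      by (auto simp: selection_def fun_eq_iff)
    then have "Q k m" unfolding Q_def using interpolable_mono[OF C m] by simp
    then show ?thesis ..
  qed
  define c where "c k = (LEAST m. Q k m)" for k
  have c: "Q k (c k)" for k unfolding c_def using Q_ex by (rule LeastI_ex)
  have c_le: "c k \<le> m" if "Q k m" for k m unfolding c_def using that by (rule Least_le)
  have c_mono: "c k \<le> c l" if "k \<le> l" for k l
  proof (rule c_le, unfold Q_def, rule allI)
    fix s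
    have "(\<lambda>n. n < k \<and> s n) = (\<lambda>n. n < l \<and> (n < k \<and> s n))" using that by auto
    then show "interpolable v z (real (c l)) (selection (\<lambda>n. 1) (\<lambda>n. n < k \<and> s n))"
      using c[of l] unfolding Q_def by metis
  qed
  have "\<exists>B. \<forall>k. c k \<le> B"
  proof (rule ccontr)
    assume "\<not> ?thesis"
    then have unb: "\<exists>k. B < c k" for B by (meson not_le)
    define w :: "nat \<Rightarrow> real" where "w n = 1 / sqrt (1 + real (c (Suc n)))" for n
    have w_pos: "0 < w n" for n by (simp add: w_def add_pos_nonneg)
    have "filterlim c at_top sequentially"
      unfolding filterlim_at_top eventually_sequentially
      using unb c_mono by (meson le_trans less_imp_le)
    then have "filterlim (\<lambda>n. c (Suc n)) at_top sequentially"
      by (rule filterlim_compose) (rule filterlim_Suc)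
    then have "filterlim (\<lambda>n. sqrt (1 + real (c (Suc n)))) at_top sequentially"
      by (intro filterlim_compose[OF sqrt_at_top] filterlim_tendsto_add_at_top[OF tendsto_const]
            filterlim_compose[OF filterlim_real_sequentially])
    then have w_lim: "w \<longlonglongrightarrow> 0"
      unfolding w_def[abs_def] by (intro tendsto_divide_0[OF tendsto_const] filterlim_at_top_imp_at_infinity)
    have "\<exists>C. interpolable v z C (selection w s)" for s
    proof (rule null)
      have "(\<lambda>n. norm (selection w s n)) \<longlonglongrightarrow> 0"
        by (rule tendsto_sandwich[OF _ _ tendsto_const w_lim])
          (auto simp: selection_def w_pos less_imp_le)
      then show "selection w s \<longlonglongrightarrow> 0" by (rule tendsto_norm_zero_cancel)
    qed
    from uniform_selections[OF v z this]
    obtain C where C: "\<And>s. interpolable v z C (selection w s)" by blast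
    have C0: "0 \<le> C" using C weighted_ball_nonneg_radius[OF v] by (auto simp: interpolable_def)
    have bound: "real (c k) \<le> C * sqrt (1 + real (c k)) + 1" for k
    proof -
      define q where "q = sqrt (1 + real (c k))"
      have q: "1 \<le> q" by (simp add: q_def)
      have "Q k (nat \<lceil>q * C\<rceil>)" unfolding Q_def
      proof
        fix s
        define b where "b n = (if n < k \<and> s n then 1 / (q * w n) else 0)" for n
        have b: "0 \<le> b n" "b n \<le> 1" for n
        proof -
          show "0 \<le> b n" using q w_pos[of n] by (simp add: b_def)
          have "1 \<le> q * w n" if "n < k"
            using c_mono[of "Suc n" k] that by (simp add: q_def w_def real_le_lsqrt field_simps)
          then show "b n \<le> 1" using q w_pos[of n] by (auto simp: b_def divide_le_eq)
        qed
        have "interpolable v z (norm (complex_of_real q) * C) (\<lambda>n. of_real q * of_real (b n * w n))"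
          by (intro interpolable_scale interpolable_box[OF v z C] b)
        also have "(\<lambda>n. complex_of_real q * of_real (b n * w n)) = selection (\<lambda>n. 1) (\<lambda>n. n < k \<and> s n)"
        proof
          fix n
          show "complex_of_real q * of_real (b n * w n) = selection (\<lambda>n. 1) (\<lambda>n. n < k \<and> s n) n"
            using q w_pos[of n] by (auto simp: b_def selection_def)
        qed
        also have "norm (complex_of_real q) = q" using q by simp
        finally show "interpolable v z (real (nat \<lceil>q * C\<rceil>)) (selection (\<lambda>n. 1) (\<lambda>n. n < k \<and> s n))"
          by (rule interpolable_mono) (rule real_nat_ceiling_ge)
      qed
      from c_le[OF this] have "real (c k) \<le> real (nat \<lceil>q * C\<rceil>)" by simp
      also have "\<dots> = of_int \<lceil>q * C\<rceil>" using q C0 by (simp add: zero_le_ceiling less_le_trans[of "-1" 0])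
      also have "\<dots> \<le> q * C + 1" by linarith
      finally show ?thesis by (simp add: q_def mult.commute)
    qed
    obtain k where k: "nat \<lceil>(C + 2)\<^sup>2\<rceil> < c k" using unb by blast
    define q where "q = sqrt (1 + real (c k))"
    have q: "1 \<le> q" "q\<^sup>2 = 1 + real (c k)" by (simp_all add: q_def)
    have "q * q \<le> C * q + 2" using bound[of k] q(2) by (simp add: q_def power2_eq_square)
    also have "\<dots> \<le> (C + 2) * q" using q(1) by (simp add: distrib_right)
    finally have "q \<le> C + 2" using q(1) by simp
    then have "1 + real (c k) \<le> (C + 2)\<^sup>2" unfolding q(2)[symmetric] using q(1) by (intro power_mono) auto
    also have "\<dots> \<le> real (nat \<lceil>(C + 2)\<^sup>2\<rceil>)" by (rule real_nat_ceiling_ge)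
    also have "\<dots> < real (c k)" using k by simp
    finally show False by simp
  qed
  then obtain B where B: "\<And>k. c k \<le> B" by blast
  have "interpolable v z (real B) (selection (\<lambda>n. 1) s)" for s
  proof (rule interpolable_limit[OF v z])
    show "interpolable v z (real B) (selection (\<lambda>n. 1) (\<lambda>n. n < k \<and> s n))" for k
    proof (rule interpolable_mono)
      show "interpolable v z (real (c k)) (selection (\<lambda>n. 1) (\<lambda>n. n < k \<and> s n))"
        using c[of k] by (simp add: Q_def)
    qed (use B[of k] in simp)
    fix n
    have "eventually (\<lambda>k. selection (\<lambda>n. 1) (\<lambda>n. n < k \<and> s n) n = selection (\<lambda>n. 1) s n) sequentially"
      using eventually_gt_at_top[of n] by eventually_elim (simp add: selection_def)
    then show "(\<lambda>k. selection (\<lambda>n. 1) (\<lambda>n. n < k \<and> s n) n) \<longlonglongrightarrow> selection (\<lambda>n. 1) s n"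
      by (rule tendsto_eventually)
  qed
  then show ?thesis by blast
qed

section \<open>Interpolation of null sequences by functions vanishing at the boundary\<close>

text \<open>
  If infinitely many points stayed in a compact part of the disk, a subsequence \<open>z (t k)\<close> would
  converge inside the disk, and by continuity the values interpolated along \<open>t\<close> would converge.
  But they can be prescribed as \<open>1, 0, 1, 0, \<dots>\<close>.
\<close>

lemma interpolable_imp_to_boundary:
  assumes v: "weight v" and z: "range z \<subseteq> unit_disk"
    and interp: "\<And>a. (\<And>n. norm (a n) \<le> 1) \<Longrightarrow> \<exists>C. interpolable v z C a"
  shows "filterlim z to_boundary sequentially"
proof -
  have zn: "norm (z n) < 1" for n using z by (auto simp: subset_iff)
  have "eventually (\<lambda>n. \<rho> < norm (z n)) sequentially" if \<rho>: "\<rho> < 1" for \<rho>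
  proof (rule ccontr)
    assume "\<not> ?thesis"
    then have "infinite {n. norm (z n) \<le> \<rho>}"
      by (auto simp: not_eventually frequently_cofinite not_less cofinite_eq_sequentially[symmetric])
    then obtain r :: "nat \<Rightarrow> nat" where r: "strict_mono r" "\<And>k. norm (z (r k)) \<le> \<rho>"
      using infinite_enumerate[of "{n. norm (z n) \<le> \<rho>}"] by auto
    have "\<forall>k. (z \<circ> r) k \<in> cball 0 \<rho>" using r(2) by simp
    then obtain l q where l: "l \<in> cball 0 \<rho>" and q: "strict_mono (q :: nat \<Rightarrow> nat)"
      "((z \<circ> r) \<circ> q) \<longlonglongrightarrow> l"
      using compact_cball[of 0 \<rho>, unfolded compact_eq_seq_compact_metric seq_compact_def] by blast
    define t where "t = r \<circ> q"
    have t: "strict_mono t" "(\<lambda>k. z (t k)) \<longlonglongrightarrow> l"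
      using strict_mono_o[OF r(1) q(1)] q(2) by (simp_all add: t_def o_def)
    have ld: "l \<in> unit_disk" using l \<rho> by simp
    define a :: "nat \<Rightarrow> complex" where "a n = of_bool (n \<in> t ` {k. even k})" for n
    have "norm (a n) \<le> 1" for n by (simp add: a_def)
    then obtain C where "interpolable v z C a" using interp by blast
    then obtain g where g: "g \<in> weighted_ball v C" "\<And>n. of_real (v (z n)) * g (z n) = a n"
      by (auto simp: interpolable_def)
    have "isCont v l" "isCont g l"
      using v g(1) ld holomorphic_on_imp_continuous_on[of g unit_disk]
      by (auto simp: weight_def weighted_ball_def continuous_on_eq_continuous_at)
    then have "(\<lambda>k. v (z (t k))) \<longlonglongrightarrow> v l" "(\<lambda>k. g (z (t k))) \<longlonglongrightarrow> g l"
      using isCont_tendsto_compose[OF _ t(2)] by blast+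
    then have "(\<lambda>k. of_real (v (z (t k))) * g (z (t k))) \<longlonglongrightarrow> of_real (v l) * g l"
      by (intro tendsto_mult tendsto_of_real)
    then have "(\<lambda>k. of_bool (even k) :: complex) \<longlonglongrightarrow> of_real (v l) * g l"
      using strict_mono_imp_inj_on[OF t(1)] by (simp add: g(2) a_def inj_image_mem_iff)
    moreover have "strict_mono (\<lambda>k::nat. 2 * k)" "strict_mono (\<lambda>k::nat. 2 * k + 1)"
      by (simp_all add: strict_mono_def)
    ultimately have "(\<lambda>k. of_bool (even (2 * k)) :: complex) \<longlonglongrightarrow> of_real (v l) * g l"
      "(\<lambda>k. of_bool (even (2 * k + 1)) :: complex) \<longlonglongrightarrow> of_real (v l) * g l"
      by (auto dest: LIMSEQ_subseq_LIMSEQ simp: o_def)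
    then show False using LIMSEQ_unique by (fastforce simp: LIMSEQ_const_iff)
  qed
  then have "(\<lambda>n. norm (z n)) \<longlonglongrightarrow> 1"
  proof (rule order_tendstoI)
    fix u :: real assume "1 < u"
    then show "eventually (\<lambda>n. norm (z n) < u) sequentially"
      by (intro always_eventually allI less_trans[OF zn])
  qed
  then have "filterlim (\<lambda>n. norm (z n)) (at_left 1) sequentially"
    using zn by (auto simp: filterlim_at less_imp_neq)
  then show ?thesis by (simp add: to_boundary_def filterlim_filtercomap_iff o_def)
qed

text \<open>
  A gliding hump. The sum chosen so far is below \<open>\<eta>\<close> from some index \<open>N\<close> on, and the next summand
  is chosen below \<open>\<eta>\<close> before \<open>N\<close>. So the large parts of the summands do not overlap: the sum of
  \<open>k\<close> terms contains \<open>B\<close> only once, and becomes small after division by \<open>k\<close>.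
\<close>

lemma small_sum_of_null_seqs:
  fixes d :: "nat \<Rightarrow> nat \<Rightarrow> complex"
  assumes null: "\<And>i. d i \<longlonglongrightarrow> 0" and pointwise: "\<And>n. (\<lambda>i. d i n) \<longlonglongrightarrow> 0"
    and bound: "\<And>i n. norm (d i n) \<le> B" and \<eta>: "0 < \<eta>"
  shows "\<exists>I. finite I \<and> card I = k \<and> (\<forall>n. norm (\<Sum>i\<in>I. d i n) \<le> B + real k * \<eta>)"
proof (induction k)
  case 0
  have "0 \<le> B" using bound[of 0 0] norm_ge_zero order_trans by blast
  then show ?case by (intro exI[of _ "{}"]) auto
next
  case (Suc k)
  then obtain I where I: "finite I" "card I = k" "\<And>n. norm (\<Sum>i\<in>I. d i n) \<le> B + real k * \<eta>" by blast
  have "(\<lambda>n. \<Sum>i\<in>I. d i n) \<longlonglongrightarrow> 0"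
    using tendsto_sum[of I d "\<lambda>_. 0" sequentially] null by simp
  then obtain N where N: "\<And>n. N \<le> n \<Longrightarrow> norm (\<Sum>i\<in>I. d i n) < \<eta>"
    using \<eta> by (force simp: lim_sequentially)
  have "eventually (\<lambda>i. \<forall>n\<in>{..<N}. norm (d i n) < \<eta>) sequentially"
    using pointwise \<eta> by (intro eventually_ball_finite) (auto simp: tendsto_iff)
  moreover have "eventually (\<lambda>i. i \<notin> I) sequentially"
    using I(1) by (simp add: cofinite_eq_sequentially[symmetric] eventually_cofinite)
  ultimately have "eventually (\<lambda>i. (\<forall>n\<in>{..<N}. norm (d i n) < \<eta>) \<and> i \<notin> I) sequentially"
    by (rule eventually_conj)
  then obtain j where j: "\<And>n. n < N \<Longrightarrow> norm (d j n) < \<eta>" "j \<notin> I"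
    using eventually_happens[of _ sequentially] by fastforce
  have "norm (\<Sum>i\<in>insert j I. d i n) \<le> B + real (Suc k) * \<eta>" for n
  proof -
    have "norm (\<Sum>i\<in>insert j I. d i n) \<le> norm (d j n) + norm (\<Sum>i\<in>I. d i n)"
      using I(1) j(2) by (simp add: norm_triangle_ineq)
    also have "\<dots> \<le> B + real (Suc k) * \<eta>"
    proof (cases "n < N")
      case True
      then show ?thesis using j(1)[of n] I(3)[of n] by (simp add: distrib_right)
    next
      case False
      have "0 \<le> real k * \<eta>" using \<eta> by simp
      then show ?thesis using False N[of n] bound[of j n] by (simp add: distrib_right)
    qed
    finally show ?thesis .
  qed
  then show ?case using I j(2) by (intro exI[of _ "insert j I"]) auto
qed

text \<open>
  The deviations \<open>d i n\<close> of the dilations with factor \<open>\<rho> i \<rightarrow> 1\<close> tend to 0 in \<open>i\<close> by continuity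
  of \<open>f\<close> at \<open>z n\<close>. They tend to 0 in \<open>n\<close> because the points approach the boundary, where the
  dilations vanish, and because the values of \<open>f\<close> form a null sequence. Thus an average of
  dilations deviates little at all points simultaneously, and the ball is convex.
\<close>

lemma vanishing_approximation:
  assumes v: "typical_weight v" and z: "range z \<subseteq> unit_disk"
    and bdry: "filterlim z to_boundary sequentially"
    and f: "f \<in> weighted_ball v C" and null: "(\<lambda>n. of_real (v (z n)) * f (z n)) \<longlonglongrightarrow> 0"
    and e: "0 < e"
  obtains g where "g \<in> weighted_ball v C" "vanishes_at_boundary v g"
    "\<And>n. norm (of_real (v (z n)) * g (z n) - of_real (v (z n)) * f (z n)) \<le> e"
proof -
  have w: "weight v" using v by (simp add: typical_weight_def)
  have zn: "z n \<in> unit_disk" for n using z by blast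
  define \<rho> where "\<rho> i = 1 - 1 / real (i + 2)" for i :: nat
  have \<rho>: "0 < \<rho> i" "\<rho> i < 1" for i by (simp_all add: \<rho>_def field_simps)
  have "(\<lambda>i. 1 / real (i + 2)) \<longlonglongrightarrow> 0"
    using LIMSEQ_ignore_initial_segment[OF lim_1_over_n, of 2] by simp
  then have \<rho>_lim: "\<rho> \<longlonglongrightarrow> 1" unfolding \<rho>_def[abs_def] using tendsto_diff[OF tendsto_const, of _ 0 _ "1::real"] by simp
  define F where "F i x = f (of_real (\<rho> i) * x)" for i x
  have F: "F i \<in> weighted_ball v C" "vanishes_at_boundary v (F i)" for i
    unfolding F_def[abs_def] by (rule weighted_ball_dilation[OF v \<rho> f])+
  define d where "d i n = of_real (v (z n)) * F i (z n) - of_real (v (z n)) * f (z n)" for i n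
  have small: "norm (of_real (v (z n)) * h (z n)) \<le> C" if "h \<in> weighted_ball v C" for h n
    using that zn[of n] w by (auto simp: weighted_ball_def weight_def norm_mult abs_of_pos)
  have d_bound: "norm (d i n) \<le> 2 * C" for i n
  proof -
    have "norm (d i n) \<le> norm (of_real (v (z n)) * F i (z n)) + norm (of_real (v (z n)) * f (z n))"
      unfolding d_def by (rule norm_triangle_ineq4)
    then show ?thesis using small[OF F(1), of n i] small[OF f, of n] by linarith
  qed
  have d_null: "d i \<longlonglongrightarrow> 0" for i
  proof -
    have "(\<lambda>n. v (z n) * norm (F i (z n))) \<longlonglongrightarrow> 0"
      using filterlim_compose[OF _ bdry] F(2)[of i] unfolding vanishes_at_boundary_def by blast
    moreover have "v (z n) * norm (F i (z n)) = norm (of_real (v (z n)) * F i (z n))" for n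
      using zn[of n] w by (simp add: weight_def norm_mult abs_of_pos)
    ultimately have "(\<lambda>n. of_real (v (z n)) * F i (z n)) \<longlonglongrightarrow> 0"
      by (simp add: tendsto_norm_zero_iff)
    from tendsto_diff[OF this null] show ?thesis by (simp add: d_def[abs_def])
  qed
  have d_pointwise: "(\<lambda>i. d i n) \<longlonglongrightarrow> 0" for n
  proof -
    have "isCont f (z n)"
      using f zn[of n] holomorphic_on_imp_continuous_on[of f unit_disk]
      by (simp add: weighted_ball_def continuous_on_eq_continuous_at)
    moreover have "(\<lambda>i. of_real (\<rho> i) * z n) \<longlonglongrightarrow> z n"
      using tendsto_mult[OF tendsto_of_real[OF \<rho>_lim] tendsto_const[of "z n"]] by simp
    ultimately have "(\<lambda>i. F i (z n)) \<longlonglongrightarrow> f (z n)"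
      unfolding F_def by (rule isCont_tendsto_compose)
    then have "(\<lambda>i. d i n) \<longlonglongrightarrow> of_real (v (z n)) * f (z n) - of_real (v (z n)) * f (z n)"
      unfolding d_def by (intro tendsto_intros)
    then show ?thesis by simp
  qed
  \<comment> \<open>In the average of \<open>k\<close> terms, the hump of size \<open>2 * C\<close> and the small terms count \<open>e / 2\<close> each.\<close>
  obtain k :: nat where k: "4 * C / e < real k" "0 < k"
    using reals_Archimedean2[of "max (4 * C / e) 0"] by auto
  have k_bound: "2 * C \<le> real k * (e / 2)" using k e by (simp add: field_simps)
  obtain I where I: "finite I" "card I = k" "\<And>n. norm (\<Sum>i\<in>I. d i n) \<le> 2 * C + real k * (e / 2)"
    using small_sum_of_null_seqs[OF d_null d_pointwise d_bound, of "e / 2" k] e by auto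
  define g where "g x = (1 / of_nat k) * (\<Sum>i\<in>I. F i x)" for x
  show ?thesis
  proof (rule that)
    have "g \<in> weighted_ball v (norm (1 / of_nat k :: complex) * (\<Sum>i\<in>I. C))"
      unfolding g_def[abs_def] by (intro weighted_ball_scale weighted_ball_sum w I(1) F)
    also have "norm (1 / of_nat k :: complex) * (\<Sum>i\<in>I. C) = C"
      using I(2) k(2) by (simp add: norm_divide)
    finally show "g \<in> weighted_ball v C" .
    show "vanishes_at_boundary v g"
      unfolding g_def[abs_def] by (intro vanishes_scale vanishes_sum w I(1) F)
    fix n
    have "(\<Sum>i\<in>I. d i n) = of_real (v (z n)) * (\<Sum>i\<in>I. F i (z n)) - of_nat k * (of_real (v (z n)) * f (z n))"
      by (simp add: d_def sum_subtractf sum_distrib_left[symmetric] I(2))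
    then have "of_real (v (z n)) * g (z n) - of_real (v (z n)) * f (z n) = (1 / of_nat k) * (\<Sum>i\<in>I. d i n)"
      using k(2) by (simp add: g_def diff_divide_distrib)
    then have "norm (of_real (v (z n)) * g (z n) - of_real (v (z n)) * f (z n)) =
        norm (\<Sum>i\<in>I. d i n) / real k"
      by (simp add: norm_mult norm_divide)
    also have "\<dots> \<le> (real k * (e / 2) + real k * (e / 2)) / real k"
    proof (rule divide_right_mono)
      show "norm (\<Sum>i\<in>I. d i n) \<le> real k * (e / 2) + real k * (e / 2)"
        using I(3)[of n] k_bound by linarith
    qed simp
    also have "\<dots> = e" using k(2) by simp
    finally show "norm (of_real (v (z n)) * g (z n) - of_real (v (z n)) * f (z n)) \<le> e" .
  qed
qed

text \<open>
  Successive correction: the \<open>k\<close>-th residual is a null sequence bounded by \<open>1 / 2 ^ k\<close>, and is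
  interpolated up to half of that by a function of weighted norm at most \<open>C / 2 ^ k\<close> vanishing at
  the boundary. The corrections form a dyadic series.
\<close>

lemma vanishing_interpolation_unit:
  assumes v: "typical_weight v" and z: "range z \<subseteq> unit_disk"
    and interp: "\<And>a. (\<And>n. norm (a n) \<le> 1) \<Longrightarrow> interpolable v z C a"
    and a: "a \<longlonglongrightarrow> 0" "\<And>n. norm (a n) \<le> 1"
  obtains g where "g \<in> weighted_ball v (2 * C)" "vanishes_at_boundary v g"
    "\<And>n. of_real (v (z n)) * g (z n) = a n"
proof -
  have w: "weight v" using v by (simp add: typical_weight_def)
  have zn: "z n \<in> unit_disk" for n using z by blast
  have bdry: "filterlim z to_boundary sequentially"
    using interpolable_imp_to_boundary[OF w z] interp by blast
  \<comment> \<open>\<open>P k\<close> describes the \<open>k\<close>-th residual, \<open>Q k\<close> the correction leading to the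
     next one; the clause for \<open>k = 0\<close> makes the recursion start at \<open>a\<close>.\<close>
  define P where "P k b \<longleftrightarrow> b \<longlonglongrightarrow> 0 \<and> (\<forall>n. norm (b n) \<le> 1 / 2 ^ k) \<and> (k = 0 \<longrightarrow> b = a)"
    for k :: nat and b :: "nat \<Rightarrow> complex"
  define Q where "Q k b c \<longleftrightarrow> (\<exists>g\<in>weighted_ball v (C / 2 ^ k). vanishes_at_boundary v g \<and>
      (\<forall>n. of_real (v (z n)) * g (z n) = b n - c n))"
    for k :: nat and b c :: "nat \<Rightarrow> complex"
  have "\<exists>c. P (Suc k) c \<and> Q k b c" if b: "P k b" for k b
  proof -
    have "interpolable v z C (\<lambda>n. 2 ^ k * b n)"
      using b by (intro interp) (simp add: P_def norm_mult norm_power field_simps)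
    from interpolable_scale[OF this, of "1 / 2 ^ k"] have "interpolable v z (C / 2 ^ k) b"
      by (simp add: norm_divide norm_power)
    then obtain f where f: "f \<in> weighted_ball v (C / 2 ^ k)" "\<And>n. of_real (v (z n)) * f (z n) = b n"
      by (auto simp: interpolable_def)
    obtain g where g: "g \<in> weighted_ball v (C / 2 ^ k)" "vanishes_at_boundary v g"
      "\<And>n. norm (of_real (v (z n)) * g (z n) - b n) \<le> 1 / 2 ^ Suc k"
      using vanishing_approximation[OF v z bdry f(1), of "1 / 2 ^ Suc k"] b
      by (auto simp: f(2) P_def)
    have "(\<lambda>n. v (z n) * norm (g (z n))) \<longlonglongrightarrow> 0"
      using filterlim_compose[OF _ bdry] g(2) unfolding vanishes_at_boundary_def by blast
    moreover have "v (z n) * norm (g (z n)) = norm (of_real (v (z n)) * g (z n))" for n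
      using zn[of n] w by (simp add: weight_def norm_mult abs_of_pos)
    ultimately have "(\<lambda>n. of_real (v (z n)) * g (z n)) \<longlonglongrightarrow> 0"
      by (simp add: tendsto_norm_zero_iff)
    then have lim: "(\<lambda>n. b n - of_real (v (z n)) * g (z n)) \<longlonglongrightarrow> 0"
      using b tendsto_diff[of b 0] by (fastforce simp: P_def)
    have "P (Suc k) (\<lambda>n. b n - of_real (v (z n)) * g (z n))"
      unfolding P_def using lim g(3) by (auto simp: norm_minus_commute)
    moreover have "Q k b (\<lambda>n. b n - of_real (v (z n)) * g (z n))"
      unfolding Q_def using g(1,2) by auto
    ultimately show ?thesis by blast
  qed
  moreover have "\<exists>b. P 0 b" using a by (auto simp: P_def)
  ultimately obtain R where R: "\<And>k. P k (R k)" "\<And>k. Q k (R k) (R (Suc k))"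
    using dependent_nat_choice[of P Q] by blast
  from R(2) have "\<forall>k. \<exists>g. g \<in> weighted_ball v (C / 2 ^ k) \<and> vanishes_at_boundary v g \<and>
      (\<forall>n. of_real (v (z n)) * g (z n) = R k n - R (Suc k) n)"
    unfolding Q_def by blast
  from choice[OF this] obtain g where g: "\<And>k. g k \<in> weighted_ball v (C / 2 ^ k)"
    "\<And>k. vanishes_at_boundary v (g k)"
    "\<And>k n. of_real (v (z n)) * g k (z n) = R k n - R (Suc k) n" by blast
  obtain G where G: "G \<in> weighted_ball v (2 * C)" "\<And>x. x \<in> unit_disk \<Longrightarrow> (\<lambda>k. g k x) sums G x"
    using weighted_ball_dyadic_series[of v g, OF w g(1)] by blast
  show ?thesis
  proof (rule that[OF G(1)])
    show "vanishes_at_boundary v G" by (rule vanishes_dyadic_series[OF w g(1,2) G(2)])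
    fix n
    have "(\<lambda>k. norm (R k n)) \<longlonglongrightarrow> 0"
    proof (rule tendsto_sandwich[OF _ _ tendsto_const])
      show "(\<lambda>k. 1 / 2 ^ k) \<longlonglongrightarrow> (0::real)"
        using LIMSEQ_power_zero[of "1/2 :: real"] by (simp add: power_one_over)
    qed (use R(1) in \<open>auto simp: P_def\<close>)
    then have "(\<lambda>k. R k n) \<longlonglongrightarrow> 0" by (rule tendsto_norm_zero_cancel)
    then have "(\<lambda>k. R k n - R (Suc k) n) sums (R 0 n - 0)" by (rule telescope_sums')
    moreover have "(\<lambda>k. of_real (v (z n)) * g k (z n)) sums (of_real (v (z n)) * G (z n))"
      by (intro sums_mult G(2) zn)
    ultimately have "of_real (v (z n)) * G (z n) = R 0 n"
      unfolding g(3) using sums_unique2 by fastforce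
    then show "of_real (v (z n)) * G (z n) = a n" using R(1)[of 0] by (simp add: P_def)
  qed
qed

section \<open>The equivalences\<close>

lemma uniform_imp_interpolates_bounded:
  assumes v: "weight v" and z: "range z \<subseteq> unit_disk"
    and interp: "\<And>a. (\<And>n. norm (a n) \<le> 1) \<Longrightarrow> interpolable v z C a"
  shows "interpolates v z bounded_seqs (bloch v)"
  unfolding interpolates_bloch_iff[OF v z]
proof
  fix a assume "a \<in> bounded_seqs"
  then obtain B where B: "0 < B" "\<And>n. norm (a n) \<le> B"
    by (auto simp: bounded_seqs_def bounded_pos)
  have "interpolable v z C (\<lambda>n. a n / of_real B)"
    using B by (intro interp) (simp add: norm_divide)
  from interpolable_scale[OF this, of "of_real B"]
  show "\<exists>C. interpolable v z C a" using B(1) by auto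
qed

lemma uniform_imp_interpolates_little:
  assumes v: "typical_weight v" and z: "range z \<subseteq> unit_disk"
    and interp: "\<And>a. (\<And>n. norm (a n) \<le> 1) \<Longrightarrow> interpolable v z C a"
  shows "interpolates v z null_seqs (little_bloch v)"
proof (rule interpolates_little_blochI[OF _ z])
  show "weight v" using v by (simp add: typical_weight_def)
  fix a assume "a \<in> null_seqs"
  then have a: "a \<longlonglongrightarrow> 0" by (simp add: null_seqs_def)
  then obtain B where B: "0 < B" "\<And>n. norm (a n) \<le> B"
    using convergent_imp_bounded by (force simp: bounded_pos)
  have "(\<lambda>n. a n / of_real B) \<longlonglongrightarrow> 0" using tendsto_divide_zero[OF a] by simp
  moreover have "norm (a n / of_real B) \<le> 1" for n using B by (simp add: norm_divide)
  ultimately obtain g where g: "g \<in> weighted_ball v (2 * C)" "vanishes_at_boundary v g"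
    "\<And>n. of_real (v (z n)) * g (z n) = a n / of_real B"
    using vanishing_interpolation_unit[OF v z interp, of "\<lambda>n. a n / of_real B"] by blast
  have "of_real (v (z n)) * (of_real B * g (z n)) = a n" for n
    using g(3)[of n] B(1) by (simp add: field_simps)
  then show "\<exists>g C. g \<in> weighted_ball v C \<and> vanishes_at_boundary v g \<and>
      (\<forall>n. of_real (v (z n)) * g (z n) = a n)"
    using weighted_ball_scale[OF g(1), of "of_real B"] vanishes_scale[OF g(2), of "of_real B"] by blast
qed

theorem theorem2p4:
  fixes v :: "complex \<Rightarrow> real" and z :: "nat \<Rightarrow> complex"
  assumes "typical_weight v"
    and "range z \<subseteq> unit_disk"
    and "inj z"
  shows "(interpolates v z bounded_seqs (bloch v) \<longleftrightarrow>
            interpolates v z null_seqs (little_bloch v)) \<and>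
         (interpolates v z null_seqs (little_bloch v) \<longleftrightarrow>
            interpolates v z null_seqs (bloch v)) \<and>
         (interpolates v z null_seqs (bloch v) \<longleftrightarrow>
            interpolates v z idempotent_seqs (bloch v))"
proof -
  have v: "weight v" and z: "range z \<subseteq> unit_disk"
    using assms by (simp_all add: typical_weight_def)
  let ?a = "interpolates v z bounded_seqs (bloch v)"
  let ?b = "interpolates v z null_seqs (little_bloch v)"
  let ?c = "interpolates v z null_seqs (bloch v)"
  let ?d = "interpolates v z idempotent_seqs (bloch v)"
  let ?U = "\<exists>C. \<forall>s. interpolable v z C (selection (\<lambda>n. 1) s)"
  have ac: ?c if ?a
    using that convergent_imp_bounded
    unfolding interpolates_def null_seqs_def bounded_seqs_def by blast
  have ad: ?d if ?a
  proof -
    have "idempotent_seqs \<subseteq> bounded_seqs"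
    proof
      fix a :: "nat \<Rightarrow> complex" assume "a \<in> idempotent_seqs"
      then have "range a \<subseteq> {0, 1}" by (auto simp: idempotent_seqs_def)
      then show "a \<in> bounded_seqs" unfolding bounded_seqs_def
        using bounded_subset[OF finite_imp_bounded[of "{0, 1 :: complex}"]] by simp
    qed
    with that show ?thesis unfolding interpolates_def by blast
  qed
  have bc: ?c if ?b using that unfolding interpolates_def little_bloch_def by blast
  have cU: ?U if ?c
    using that null_interpolation_imp_uniform_selections[OF v z]
    unfolding interpolates_bloch_iff[OF v z] null_seqs_def by blast
  have dU: ?U if ?d
  proof (rule uniform_selections[OF v z])
    fix s
    have "selection (\<lambda>n. 1) s \<in> idempotent_seqs" by (simp add: idempotent_seqs_def selection_def)
    with that show "\<exists>C. interpolable v z C (selection (\<lambda>n. 1) s)"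
      unfolding interpolates_bloch_iff[OF v z] by blast
  qed
  have Uab: "?a \<and> ?b" if U: ?U
  proof -
    obtain C where "\<And>s. interpolable v z C (selection (\<lambda>n. 1) s)" using U by blast
    from interpolable_complex_box[OF v z this]
    have "interpolable v z (4 * C) a" if "\<And>n. norm (a n) \<le> 1" for a using that by blast
    then show ?thesis
      using uniform_imp_interpolates_bounded[OF v z] uniform_imp_interpolates_little[OF assms(1) z] by blast
  qed
  show ?thesis using ac ad bc cU dU Uab by blast
qed

end
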